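(* Let $(A,\cdot,\circ)$ be a skew brace. Then $A$ is $L$-nilpotent if and only if $A$ is left nilpotent and $(A,\cdot)$ is a nilpotent group.
   Context: A skew brace $(A,\cdot,\circ)$ is a set $A$ with two group structures such that $a\circ(b\cdot c)=(a\circ b)\cdot a^{-1}\cdot(a\circ c)$ for all $a,b,c\in A$, where $a^{-1}$ is the inverse of $a$ in $(A,\cdot)$. Put $a*b=a^{-1}\cdot(a\circ b)\cdot b^{-1}$. $A$ is left nilpotent if $A^n=1$ for some $n$, where $A^1=A$ and $A^{i+1}$ is the subgroup of $(A,\cdot)$ generated by all $a*b$ with $a\in A$, $b\in A^i$. Define $L^1(A)=A$ and let $L^{i+1}(A)$ be the subgroup of $(A,\cdot)$ generated by all $a*b$ and $a\cdot b\cdot a^{-1}\cdot b^{-1}$ with $a\in A$, $b\in L^i(A)$. $A$ is $L$-nilpotent if $L^{k+1}(A)=1$ for some $k\ge0$. *)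

theory Defs
  imports "HOL-Algebra.Algebra"
begin

text \<open>
  A skew brace \<open>(A, \<cdot>, \<circ>)\<close> is given by two group records on a common carrier \<open>A\<close>:
  \<open>G = (A, \<cdot>)\<close> and \<open>H = (A, \<circ>)\<close>. In particular \<open>inv\<^bsub>G\<^esub>\<close> is the inverse for \<open>\<cdot>\<close>.
\<close>

locale skew_brace = G: group G + H: group H
  for G :: "('a, 'm) monoid_scheme" and H :: "('a, 'n) monoid_scheme" +
  assumes carrier_eq: "carrier H = carrier G"
    and brace_distrib:
      "\<lbrakk>a \<in> carrier G; b \<in> carrier G; c \<in> carrier G\<rbrakk> \<Longrightarrow>
        a \<otimes>\<^bsub>H\<^esub> (b \<otimes>\<^bsub>G\<^esub> c) = (a \<otimes>\<^bsub>H\<^esub> b) \<otimes>\<^bsub>G\<^esub> inv\<^bsub>G\<^esub> a \<otimes>\<^bsub>G\<^esub> (a \<otimes>\<^bsub>H\<^esub> c)"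

definition brace_star ::
  "('a, 'm) monoid_scheme \<Rightarrow> ('a, 'n) monoid_scheme \<Rightarrow> 'a \<Rightarrow> 'a \<Rightarrow> 'a" where
  "brace_star G H a b = inv\<^bsub>G\<^esub> a \<otimes>\<^bsub>G\<^esub> (a \<otimes>\<^bsub>H\<^esub> b) \<otimes>\<^bsub>G\<^esub> inv\<^bsub>G\<^esub> b"

definition group_commutator :: "('a, 'm) monoid_scheme \<Rightarrow> 'a \<Rightarrow> 'a \<Rightarrow> 'a" where
  "group_commutator G a b = a \<otimes>\<^bsub>G\<^esub> b \<otimes>\<^bsub>G\<^esub> inv\<^bsub>G\<^esub> a \<otimes>\<^bsub>G\<^esub> inv\<^bsub>G\<^esub> b"

text \<open>
  The series below are indexed from \<open>0\<close> rather than from \<open>1\<close>: \<open>left_series G H n\<close> is \<open>A\<^sup>n\<^sup>+\<^sup>1\<close>,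
  \<open>L_series G H n\<close> is \<open>L\<^sup>n\<^sup>+\<^sup>1(A)\<close>, and \<open>lower_central_series G n\<close> is \<open>\<gamma>\<^sub>n\<^sub>+\<^sub>1(G)\<close>.
\<close>

primrec left_series ::
  "('a, 'm) monoid_scheme \<Rightarrow> ('a, 'n) monoid_scheme \<Rightarrow> nat \<Rightarrow> 'a set" where
  "left_series G H 0 = carrier G"
| "left_series G H (Suc n) =
    generate G {brace_star G H a b | a b. a \<in> carrier G \<and> b \<in> left_series G H n}"

definition left_nilpotent ::
  "('a, 'm) monoid_scheme \<Rightarrow> ('a, 'n) monoid_scheme \<Rightarrow> bool" where
  "left_nilpotent G H \<longleftrightarrow> (\<exists>n. left_series G H n = {\<one>\<^bsub>G\<^esub>})"

primrec L_series ::
  "('a, 'm) monoid_scheme \<Rightarrow> ('a, 'n) monoid_scheme \<Rightarrow> nat \<Rightarrow> 'a set" where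
  "L_series G H 0 = carrier G"
| "L_series G H (Suc n) =
    generate G ({brace_star G H a b | a b. a \<in> carrier G \<and> b \<in> L_series G H n} \<union>
                {group_commutator G a b | a b. a \<in> carrier G \<and> b \<in> L_series G H n})"

definition L_nilpotent ::
  "('a, 'm) monoid_scheme \<Rightarrow> ('a, 'n) monoid_scheme \<Rightarrow> bool" where
  "L_nilpotent G H \<longleftrightarrow> (\<exists>k. L_series G H k = {\<one>\<^bsub>G\<^esub>})"

primrec lower_central_series :: "('a, 'm) monoid_scheme \<Rightarrow> nat \<Rightarrow> 'a set" where
  "lower_central_series G 0 = carrier G"
| "lower_central_series G (Suc n) =
    generate G {group_commutator G a b | a b. a \<in> carrier G \<and> b \<in> lower_central_series G n}"

definition nilpotent_group :: "('a, 'm) monoid_scheme \<Rightarrow> bool" where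
  "nilpotent_group G \<longleftrightarrow> group G \<and> (\<exists>n. lower_central_series G n = {\<one>\<^bsub>G\<^esub>})"

end

theory Submission
  imports Defs
begin

text \<open>
  The left series and the lower central series both lie inside the \<open>L\<close>-series, because each of
  their steps uses only some of the generators of the corresponding step of the \<open>L\<close>-series. This
  gives one direction.

  For the converse, write \<open>\<lambda>\<^sub>g(b) = g\<inverse> \<cdot> (g \<circ> b)\<close>. The brace identity says exactly that
  \<open>\<lambda>\<^sub>g\<close> is an endomorphism of \<open>(A, \<cdot>)\<close>, and \<open>g * b = \<lambda>\<^sub>g(b) \<cdot> b\<inverse>\<close>. The terms \<open>\<gamma>\<^sub>i\<close> of the lower
  central series, with \<open>\<gamma>\<^sub>0 = A\<close>, are fully invariant, so they are normal and stable under every \<open>\<lambda>\<^sub>g\<close>. The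
  idea is to look at one factor \<open>\<gamma>\<^sub>i / \<gamma>\<^sub>i\<^sub>+\<^sub>1\<close> at a time. It is central in \<open>A / \<gamma>\<^sub>i\<^sub>+\<^sub>1\<close>, so the
  commutators among the generators of the \<open>L\<close>-series vanish there, and only the elements
  \<open>g * b\<close> remain: modulo \<open>\<gamma>\<^sub>i\<^sub>+\<^sub>1\<close> the \<open>L\<close>-series descends at least as fast as the left series
  (lemma \<open>L_series_subset_left_series_mod\<close>).
  Hence if the left series is trivial after \<open>m\<close> steps, then \<open>m\<close> steps of the \<open>L\<close>-series lead
  from \<open>\<gamma>\<^sub>i\<close> into \<open>\<gamma>\<^sub>i\<^sub>+\<^sub>1\<close> (lemma \<open>L_series_next_central_factor\<close>), and \<open>c \<cdot> m\<close> steps suffice for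
  nilpotency class \<open>c\<close>.
\<close>

section \<open>The lower central series\<close>

context group
begin

lemma group_commutator_closed:
  "\<lbrakk>a \<in> carrier G; b \<in> carrier G\<rbrakk> \<Longrightarrow> group_commutator G a b \<in> carrier G"
  by (simp add: group_commutator_def)

lemma hom_group_commutator:
  assumes "f \<in> hom G G" "a \<in> carrier G" "b \<in> carrier G"
  shows "f (group_commutator G a b) = group_commutator G (f a) (f b)"
proof -
  interpret group_hom G G f
    using assms(1) by unfold_locales
  show ?thesis
    using assms(2,3) by (simp add: group_commutator_def)
qed

lemma lower_central_series_subgroup: "subgroup (lower_central_series G n) G"
proof (induction n)
  case 0
  show ?case by (simp add: subgroup_self)
next
  case (Suc n)
  show ?case
    using subgroup.subset[OF Suc]
    by (auto intro!: generate_is_subgroup group_commutator_closed)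
qed

lemma lower_central_series_fully_invariant:
  assumes f: "f \<in> hom G G"
  shows "x \<in> lower_central_series G n \<Longrightarrow> f x \<in> lower_central_series G n"
proof (induction n arbitrary: x)
  case 0
  then show ?case using f by (auto simp: hom_def)
next
  case (Suc n)
  let ?S = "{group_commutator G a b | a b. a \<in> carrier G \<and> b \<in> lower_central_series G n}"
  interpret group_hom G G f
    using f by unfold_locales
  have sub: "lower_central_series G n \<subseteq> carrier G"
    by (rule subgroup.subset[OF lower_central_series_subgroup])
  have S: "?S \<subseteq> carrier G"
    using sub by (auto intro: group_commutator_closed)
  have "f ` ?S \<subseteq> ?S"
  proof
    fix y assume "y \<in> f ` ?S"
    then obtain a b where ab: "a \<in> carrier G" "b \<in> lower_central_series G n"
      and y: "y = f (group_commutator G a b)" by auto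
    have "y = group_commutator G (f a) (f b)"
      using ab sub y hom_group_commutator[OF f] by auto
    moreover have "f a \<in> carrier G" "f b \<in> lower_central_series G n"
      using ab Suc.IH by simp_all
    ultimately show "y \<in> ?S" by blast
  qed
  then have "generate G (f ` ?S) \<subseteq> generate G ?S"
    by (rule mono_generate)
  then show ?case
    using Suc.prems generate_img[OF S] by auto
qed

text \<open>Conjugation is an endomorphism, so full invariance contains normality.\<close>

lemma lower_central_series_normal: "lower_central_series G n \<lhd> G"
proof (rule normal_invI[OF lower_central_series_subgroup])
  fix g x assume g: "g \<in> carrier G" and x: "x \<in> lower_central_series G n"
  have "(\<lambda>y. g \<otimes> y \<otimes> inv g) \<in> hom G G"
  proof (rule homI)
    fix y z assume "y \<in> carrier G" "z \<in> carrier G"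
    then have "g \<otimes> y \<otimes> inv g \<otimes> (g \<otimes> z \<otimes> inv g) = g \<otimes> y \<otimes> (inv g \<otimes> g) \<otimes> z \<otimes> inv g"
      using g by (simp only: m_assoc m_closed inv_closed)
    then show "g \<otimes> (y \<otimes> z) \<otimes> inv g = g \<otimes> y \<otimes> inv g \<otimes> (g \<otimes> z \<otimes> inv g)"
      using g \<open>y \<in> carrier G\<close> \<open>z \<in> carrier G\<close> by (simp add: m_assoc)
  qed (use g in simp)
  from lower_central_series_fully_invariant[OF this x]
  show "g \<otimes> x \<otimes> inv g \<in> lower_central_series G n" .
qed

lemma group_commutator_in_lower_central_series_Suc:
  "\<lbrakk>a \<in> carrier G; b \<in> lower_central_series G n\<rbrakk>
    \<Longrightarrow> group_commutator G a b \<in> lower_central_series G (Suc n)"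
  by (auto intro!: generate.incl)

lemma lower_central_series_Suc_subset:
  "lower_central_series G (Suc n) \<subseteq> lower_central_series G n"
proof -
  interpret N: normal "lower_central_series G n" G
    by (rule lower_central_series_normal)
  have "{group_commutator G a b | a b. a \<in> carrier G \<and> b \<in> lower_central_series G n}
    \<subseteq> lower_central_series G n"
    by (auto simp: group_commutator_def N.inv_op_closed2)
  then show ?thesis
    unfolding lower_central_series.simps
    by (rule generate_subgroup_incl[OF _ lower_central_series_subgroup])
qed

end

section \<open>The action of a skew brace on its additive group\<close>

definition brace_action ::
  "('a, 'm) monoid_scheme \<Rightarrow> ('a, 'n) monoid_scheme \<Rightarrow> 'a \<Rightarrow> 'a \<Rightarrow> 'a" where
  "brace_action G H a b = inv\<^bsub>G\<^esub> a \<otimes>\<^bsub>G\<^esub> (a \<otimes>\<^bsub>H\<^esub> b)"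

context skew_brace
begin

lemma circ_closed: "\<lbrakk>a \<in> carrier G; b \<in> carrier G\<rbrakk> \<Longrightarrow> a \<otimes>\<^bsub>H\<^esub> b \<in> carrier G"
  using H.m_closed[of a b] by (simp add: carrier_eq)

lemma brace_action_hom: "a \<in> carrier G \<Longrightarrow> brace_action G H a \<in> hom G G"
  by (auto simp: hom_def brace_action_def circ_closed brace_distrib G.m_assoc)

lemma brace_action_closed:
  "\<lbrakk>a \<in> carrier G; b \<in> carrier G\<rbrakk> \<Longrightarrow> brace_action G H a b \<in> carrier G"
  by (simp add: brace_action_def circ_closed)

lemma brace_star_eq_action: "brace_star G H a b = brace_action G H a b \<otimes>\<^bsub>G\<^esub> inv\<^bsub>G\<^esub> b"
  by (simp add: brace_star_def brace_action_def)

lemma brace_star_closed: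
  "\<lbrakk>a \<in> carrier G; b \<in> carrier G\<rbrakk> \<Longrightarrow> brace_star G H a b \<in> carrier G"
  by (simp add: brace_star_eq_action brace_action_closed)

lemma brace_star_in_lower_central_series:
  assumes "a \<in> carrier G" "b \<in> lower_central_series G n"
  shows "brace_star G H a b \<in> lower_central_series G n"
proof -
  interpret S: subgroup "lower_central_series G n" G
    by (rule G.lower_central_series_subgroup)
  show ?thesis
    using assms G.lower_central_series_fully_invariant[OF brace_action_hom]
    by (simp add: brace_star_eq_action)
qed

text \<open>
  Modulo a normal subgroup \<open>N\<close>, left multiplication of \<open>a\<close> by \<open>z \<in> N\<close> does not change \<open>g * a\<close>,
  as soon as \<open>\<lambda>\<^sub>g(z)\<close> stays in \<open>N\<close>:
  in \<open>g * (z \<cdot> a) = \<lambda>\<^sub>g(z) \<cdot> (g * a) \<cdot> z\<inverse>\<close> the factor \<open>z\<inverse>\<close> can be moved to the left of \<open>g * a\<close> by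
  conjugation, which keeps it in \<open>N\<close>.
\<close>

lemma brace_star_normal_mult:
  assumes N: "N \<lhd> G" and inv: "brace_action G H g z \<in> N"
    and g: "g \<in> carrier G" and z: "z \<in> N" and a: "a \<in> carrier G"
  shows "\<exists>w\<in>N. brace_star G H g (z \<otimes>\<^bsub>G\<^esub> a) = w \<otimes>\<^bsub>G\<^esub> brace_star G H g a"
proof -
  interpret N: normal N G by (rule N)
  let ?l = "brace_action G H g" and ?s = "brace_star G H g a"
  let ?w = "?l z \<otimes>\<^bsub>G\<^esub> (?s \<otimes>\<^bsub>G\<^esub> inv\<^bsub>G\<^esub> z \<otimes>\<^bsub>G\<^esub> inv\<^bsub>G\<^esub> ?s)"
  have zc: "z \<in> carrier G" using z by simp
  have sc: "?s \<in> carrier G" using g a by (rule brace_star_closed)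
  have lz: "?l z \<in> carrier G" and la: "?l a \<in> carrier G"
    using g a zc by (simp_all add: brace_action_closed)
  have "?w \<in> N"
    using inv z sc by (simp add: N.inv_op_closed2)
  moreover have "?l (z \<otimes>\<^bsub>G\<^esub> a) = ?l z \<otimes>\<^bsub>G\<^esub> ?l a"
    using brace_action_hom[OF g] zc a by (simp add: hom_def)
  then have "brace_star G H g (z \<otimes>\<^bsub>G\<^esub> a) = ?l z \<otimes>\<^bsub>G\<^esub> (?s \<otimes>\<^bsub>G\<^esub> inv\<^bsub>G\<^esub> z)"
    using zc a lz la by (simp add: brace_star_eq_action G.inv_mult_group G.m_assoc)
  then have "brace_star G H g (z \<otimes>\<^bsub>G\<^esub> a) = ?w \<otimes>\<^bsub>G\<^esub> ?s"
    using zc lz sc by (simp add: G.m_assoc)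
  ultimately show ?thesis by blast
qed

section \<open>Comparison of the three series\<close>

lemma left_series_subgroup: "subgroup (left_series G H n) G"
proof (induction n)
  case 0
  show ?case by (simp add: G.subgroup_self)
next
  case (Suc n)
  show ?case
    using subgroup.subset[OF Suc]
    by (auto intro!: G.generate_is_subgroup brace_star_closed)
qed

lemma L_series_subgroup: "subgroup (L_series G H n) G"
proof (induction n)
  case 0
  show ?case by (simp add: G.subgroup_self)
next
  case (Suc n)
  show ?case
    using subgroup.subset[OF Suc]
    by (auto intro!: G.generate_is_subgroup brace_star_closed G.group_commutator_closed)
qed

lemma left_series_subset_L_series: "left_series G H n \<subseteq> L_series G H n"
proof (induction n)
  case 0
  show ?case by simp
next
  case (Suc n)
  show ?case
    unfolding left_series.simps L_series.simps
    by (rule G.mono_generate) (use Suc in blast)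
qed

lemma lower_central_series_subset_L_series: "lower_central_series G n \<subseteq> L_series G H n"
proof (induction n)
  case 0
  show ?case by simp
next
  case (Suc n)
  show ?case
    unfolding lower_central_series.simps L_series.simps
    by (rule G.mono_generate) (use Suc in blast)
qed

lemma brace_star_in_left_series_Suc:
  "\<lbrakk>a \<in> carrier G; b \<in> left_series G H n\<rbrakk> \<Longrightarrow> brace_star G H a b \<in> left_series G H (Suc n)"
  by (auto intro!: generate.incl)

text \<open>
  Both bounds are carried through the induction together: membership in \<open>\<gamma>\<^sub>i\<close> is what sends the
  commutators into \<open>\<gamma>\<^sub>i\<^sub>+\<^sub>1\<close>, and so keeps them from disturbing the descent along the left series.
\<close>

lemma L_series_subset_left_series_mod:
  assumes "L_series G H n \<subseteq> lower_central_series G i"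
  shows "L_series G H (n + k) \<subseteq>
    lower_central_series G i \<inter> (lower_central_series G (Suc i) <#>\<^bsub>G\<^esub> left_series G H k)"
proof (induction k)
  case 0
  interpret N: subgroup "lower_central_series G (Suc i)" G
    by (rule G.lower_central_series_subgroup)
  have "x \<in> lower_central_series G (Suc i) <#>\<^bsub>G\<^esub> carrier G" if "x \<in> carrier G" for x
    using that N.one_closed G.l_one[OF that, symmetric] unfolding set_mult_def by blast
  then show ?case
    using assms subgroup.subset[OF L_series_subgroup] by auto
next
  case (Suc k)
  let ?M = "lower_central_series G i" and ?N = "lower_central_series G (Suc i)"
  let ?A = "left_series G H"
  interpret N: normal ?N G
    by (rule G.lower_central_series_normal)
  interpret A: subgroup "?A (Suc k)" G
    by (rule left_series_subgroup)
  have sub: "subgroup (?M \<inter> (?N <#>\<^bsub>G\<^esub> ?A (Suc k))) G"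
    by (intro G.subgroups_Inter_pair G.lower_central_series_subgroup G.mult_norm_subgroup
        N.normal_axioms left_series_subgroup)
  have star: "brace_star G H g b \<in> ?M \<inter> (?N <#>\<^bsub>G\<^esub> ?A (Suc k))"
    if g: "g \<in> carrier G" and b: "b \<in> L_series G H (n + k)" for g b
  proof
    have bM: "b \<in> ?M" and bNA: "b \<in> ?N <#>\<^bsub>G\<^esub> ?A k"
      using subsetD[OF Suc b] by (rule IntD1, rule IntD2)
    show "brace_star G H g b \<in> ?M"
      using g bM by (rule brace_star_in_lower_central_series)
    obtain z a where z: "z \<in> ?N" and a: "a \<in> ?A k" and b_eq: "b = z \<otimes>\<^bsub>G\<^esub> a"
      using bNA unfolding set_mult_def by blast
    have "a \<in> carrier G"
      using a subgroup.subset[OF left_series_subgroup] by blast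
    moreover have "brace_action G H g z \<in> ?N"
      using G.lower_central_series_fully_invariant[OF brace_action_hom[OF g] z] .
    ultimately obtain w where "w \<in> ?N" "brace_star G H g b = w \<otimes>\<^bsub>G\<^esub> brace_star G H g a"
      using brace_star_normal_mult[OF N.normal_axioms _ g z] b_eq by blast
    then show "brace_star G H g b \<in> ?N <#>\<^bsub>G\<^esub> ?A (Suc k)"
      using brace_star_in_left_series_Suc[OF g a] unfolding set_mult_def by blast
  qed
  have comm: "group_commutator G g b \<in> ?M \<inter> (?N <#>\<^bsub>G\<^esub> ?A (Suc k))"
    if g: "g \<in> carrier G" and b: "b \<in> L_series G H (n + k)" for g b
  proof -
    have c: "group_commutator G g b \<in> ?N"
      by (rule G.group_commutator_in_lower_central_series_Suc[OF g IntD1[OF subsetD[OF Suc b]]])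
    have "group_commutator G g b \<otimes>\<^bsub>G\<^esub> \<one>\<^bsub>G\<^esub> \<in> ?N <#>\<^bsub>G\<^esub> ?A (Suc k)"
      using c A.one_closed unfolding set_mult_def by blast
    then have "group_commutator G g b \<in> ?N <#>\<^bsub>G\<^esub> ?A (Suc k)"
      by (simp only: G.r_one[OF N.mem_carrier[OF c]])
    moreover have "group_commutator G g b \<in> ?M"
      using c by (rule subsetD[OF G.lower_central_series_Suc_subset])
    ultimately show ?thesis by (rule IntI[rotated])
  qed
  show ?case
    unfolding add_Suc_right L_series.simps
    by (rule G.generate_subgroup_incl[OF _ sub]) (use star comm in blast)
qed

lemma L_series_next_central_factor:
  assumes "left_series G H m = {\<one>\<^bsub>G\<^esub>}" and "L_series G H n \<subseteq> lower_central_series G i"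
  shows "L_series G H (n + m) \<subseteq> lower_central_series G (Suc i)"
proof -
  interpret N: subgroup "lower_central_series G (Suc i)" G
    by (rule G.lower_central_series_subgroup)
  have "lower_central_series G (Suc i) <#>\<^bsub>G\<^esub> {\<one>\<^bsub>G\<^esub>} \<subseteq> lower_central_series G (Suc i)"
    using N.mem_carrier by (auto simp: set_mult_def simp del: lower_central_series.simps)
  then show ?thesis
    using L_series_subset_left_series_mod[OF assms(2), of m] assms(1) by auto
qed

lemma L_series_subset_lower_central_series:
  assumes "left_series G H m = {\<one>\<^bsub>G\<^esub>}"
  shows "L_series G H (i * m) \<subseteq> lower_central_series G i"
proof (induction i)
  case 0
  show ?case by simp
next
  case (Suc i)
  show ?case
    using L_series_next_central_factor[OF assms Suc] by (simp add: add.commute)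
qed

end

theorem lemma4p11:
  fixes G :: "('a, 'm) monoid_scheme" and H :: "('a, 'n) monoid_scheme"
  assumes "skew_brace G H"
  shows "L_nilpotent G H \<longleftrightarrow> left_nilpotent G H \<and> nilpotent_group G"
proof -
  interpret skew_brace G H by (rule assms)
  show ?thesis
  proof
    assume "L_nilpotent G H"
    then obtain k where "L_series G H k = {\<one>\<^bsub>G\<^esub>}"
      by (auto simp: L_nilpotent_def)
    then have "left_series G H k = {\<one>\<^bsub>G\<^esub>}" "lower_central_series G k = {\<one>\<^bsub>G\<^esub>}"
      using left_series_subset_L_series[of k] lower_central_series_subset_L_series[of k]
        subgroup.one_closed[OF left_series_subgroup[of k]]
        subgroup.one_closed[OF G.lower_central_series_subgroup[of k]]
      by auto
    then show "left_nilpotent G H \<and> nilpotent_group G"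
      using G.is_group by (auto simp: left_nilpotent_def nilpotent_group_def)
  next
    assume "left_nilpotent G H \<and> nilpotent_group G"
    then obtain m c where m: "left_series G H m = {\<one>\<^bsub>G\<^esub>}"
      and c: "lower_central_series G c = {\<one>\<^bsub>G\<^esub>}"
      by (auto simp: left_nilpotent_def nilpotent_group_def)
    have "L_series G H (c * m) = {\<one>\<^bsub>G\<^esub>}"
      using L_series_subset_lower_central_series[OF m, of c] c
        subgroup.one_closed[OF L_series_subgroup[of "c * m"]]
      by auto
    then show "L_nilpotent G H"
      by (auto simp: L_nilpotent_def)
  qed
qed

end
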